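(* Let $M$ be a proper pointed metric space and let $X$ be a non-zero real Banach space. If $S(M)$ is infinite-dimensional, then $S(M,X)$ is unconditionally almost square (UASQ); in particular, $S(M,X)$ is not a dual Banach space, i.e. it is not isometrically isomorphic to the dual of any Banach space. In particular, when $M$ is compact, the same results hold for $lip(M,X)$: if $lip(M)$ is infinite-dimensional, then $lip(M,X)$ is UASQ and is not isometrically isomorphic to the dual of any Banach space.
   Context: All Banach spaces are real; $S_Z$ denotes the unit sphere of a Banach space $Z$. A pointed metric space is a metric space $(M,d)$ with a designated origin $0\in M$; it is proper if all closed balls are compact. $B(x,r)$ is the open ball. For a Banach space $X$, $Lip(M,X)$ is the Banach space of Lipschitz functions $f:M\to X$ with $f(0)=0$, with norm $\|f\|=\sup_{x\neq y}\frac{\|f(x)-f(y)\|}{d(x,y)}$. $lip(M,X)$ is the subspace of those $f\in Lip(M,X)$ with $\lim_{\varepsilon\to0}\sup_{0<d(x,y)<\varepsilon}\frac{\|f(x)-f(y)\|}{d(x,y)}=0$. $S(M,X)$ is the subspace of those $f\in lip(M,X)$ with $\lim_{r\to\infty}\sup\left\{\frac{\|f(x)-f(y)\|}{d(x,y)}: x\ne y,\ x\notin B(0,r)\text{ or }y\notin B(0,r)\right\}=0$. Suprema over empty sets are $0$. $lip(M)=lip(M,\mathbb R)$ and $S(M)=S(M,\mathbb R)$. (For compact $M$, $S(M,X)=lip(M,X)$.) A Banach space $Z$ is called unconditionally almost square (UASQ) if for each $\varepsilon>0$ there exists a subset $\{x_\gamma\}_{\gamma\in\Gamma}\subseteq S_Z$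 (depending on $\varepsilon$) such that: (1) for each finite set $\{y_1,\ldots,y_k\}\subseteq S_Z$ and each $\delta>0$ the set $\{\gamma\in\Gamma : \|y_i\pm x_\gamma\|\le 1+\delta\ \text{for all } i\in\{1,\ldots,k\}\}$ is non-empty; (2) for every finite subset $F$ of $\Gamma$ and every choice of signs $\xi_\gamma\in\{-1,1\}$, $\gamma\in F$, one has $\left\|\sum_{\gamma\in F}\xi_\gamma x_\gamma\right\|\le 1+\varepsilon$. *)

theory Defs
  imports "HOL-Analysis.Analysis"
begin

section \<open>Spaces of Lipschitz functions on a pointed metric space\<close>

class pointed_metric_space = metric_space +
  fixes origin :: 'a

text \<open>
  The supremum of the difference quotients of \<open>f\<close> over the pairs in \<open>D\<close>. Inserting \<open>0\<close> makes
  the supremum over the empty set equal to \<open>0\<close> and changes nothing otherwise, because the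
  quotients are nonnegative. It is only meant for sets \<open>D\<close> on which the quotients are bounded,
  which is always the case for Lipschitz \<open>f\<close>.
\<close>

definition slope_sup :: "('m::metric_space \<Rightarrow> 'x::real_normed_vector) \<Rightarrow> ('m \<times> 'm) set \<Rightarrow> real"
  where "slope_sup f D = Sup (insert 0 ((\<lambda>(x, y). norm (f x - f y) / dist x y) ` D))"

typedef (overloaded) ('m::pointed_metric_space, 'x::real_normed_vector) Lip =
  "{f :: 'm \<Rightarrow> 'x. f origin = 0 \<and> (\<exists>C. C-lipschitz_on UNIV f)}"
  morphisms Lip_fun Lip
proof
  show "(\<lambda>_. 0) \<in> {f :: 'm \<Rightarrow> 'x. f origin = 0 \<and> (\<exists>C. C-lipschitz_on UNIV f)}"
    by (auto intro!: exI[of _ 0] lipschitz_onI)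
qed

setup_lifting type_definition_Lip

instantiation Lip :: (pointed_metric_space, real_normed_vector) real_vector
begin

lift_definition zero_Lip :: "('a, 'b) Lip" is "\<lambda>_. 0"
  by (auto intro!: exI[of _ 0] lipschitz_onI)

lift_definition plus_Lip :: "('a, 'b) Lip \<Rightarrow> ('a, 'b) Lip \<Rightarrow> ('a, 'b) Lip"
  is "\<lambda>f g x. f x + g x"
  by (auto intro: lipschitz_on_add)

lift_definition minus_Lip :: "('a, 'b) Lip \<Rightarrow> ('a, 'b) Lip \<Rightarrow> ('a, 'b) Lip"
  is "\<lambda>f g x. f x - g x"
  by (auto intro: lipschitz_on_diff)

lift_definition uminus_Lip :: "('a, 'b) Lip \<Rightarrow> ('a, 'b) Lip" is "\<lambda>f x. - f x"
  by (auto simp: lipschitz_on_minus_iff)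

lift_definition scaleR_Lip :: "real \<Rightarrow> ('a, 'b) Lip \<Rightarrow> ('a, 'b) Lip" is "\<lambda>c f x. c *\<^sub>R f x"
  by (auto intro: lipschitz_on_cmult)

instance
proof
  fix f g h :: "('a, 'b) Lip" and a b :: real
  show "f + g + h = f + (g + h)" by transfer (simp add: add.assoc)
  show "f + g = g + f" by transfer (simp add: add.commute)
  show "0 + f = f" by transfer simp
  show "- f + f = 0" by transfer simp
  show "f - g = f + - g" by transfer simp
  show "a *\<^sub>R (f + g) = a *\<^sub>R f + a *\<^sub>R g" by transfer (simp add: scaleR_add_right)
  show "(a + b) *\<^sub>R f = a *\<^sub>R f + b *\<^sub>R f" by transfer (simp add: scaleR_add_left)
  show "a *\<^sub>R b *\<^sub>R f = (a * b) *\<^sub>R f" by transfer simp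
  show "1 *\<^sub>R f = f" by transfer simp
qed

end

instantiation Lip :: (pointed_metric_space, real_normed_vector) real_normed_vector
begin

definition norm_Lip :: "('a, 'b) Lip \<Rightarrow> real"
  where "norm_Lip f = slope_sup (Lip_fun f) {(x, y). x \<noteq> y}"

definition dist_Lip :: "('a, 'b) Lip \<Rightarrow> ('a, 'b) Lip \<Rightarrow> real"
  where "dist_Lip f g = norm (f - g)"

definition sgn_Lip :: "('a, 'b) Lip \<Rightarrow> ('a, 'b) Lip"
  where "sgn_Lip f = f /\<^sub>R norm f"

definition uniformity_Lip :: "(('a, 'b) Lip \<times> ('a, 'b) Lip) filter"
  where "uniformity_Lip = (INF e\<in>{0<..}. principal {(f, g). dist f g < e})"

definition open_Lip :: "('a, 'b) Lip set \<Rightarrow> bool"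
  where "open_Lip U = (\<forall>f\<in>U. eventually (\<lambda>(f', g). f' = f \<longrightarrow> g \<in> U) uniformity)"

lemma Lip_slopes_bdd:
  fixes f :: "('a, 'b) Lip"
  shows "bdd_above (insert 0 ((\<lambda>(x, y). norm (Lip_fun f x - Lip_fun f y) / dist x y) ` D))"
proof -
  obtain C where C: "C-lipschitz_on UNIV (Lip_fun f)"
    using Lip_fun[of f] by auto
  have "norm (Lip_fun f x - Lip_fun f y) / dist x y \<le> C" for x y
  proof (cases "x = y")
    case True
    then show ?thesis using lipschitz_on_nonneg[OF C] by simp
  next
    case False
    then show ?thesis
      using lipschitz_onD[OF C, of x y] by (simp add: dist_norm divide_le_eq)
  qed
  then show ?thesis
    using lipschitz_on_nonneg[OF C] by (intro bdd_aboveI[of _ C]) auto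
qed

lemma slope_sup_nonneg: "0 \<le> slope_sup (Lip_fun (f :: ('a, 'b) Lip)) D"
  unfolding slope_sup_def by (intro cSup_upper Lip_slopes_bdd) simp

lemma slope_sup_upper:
  fixes f :: "('a, 'b) Lip"
  assumes "(x, y) \<in> D"
  shows "norm (Lip_fun f x - Lip_fun f y) / dist x y \<le> slope_sup (Lip_fun f) D"
  unfolding slope_sup_def by (intro cSup_upper Lip_slopes_bdd) (use assms in force)

lemma slope_sup_least:
  assumes "0 \<le> C" "\<And>x y. (x, y) \<in> D \<Longrightarrow> norm (f x - f y) / dist x y \<le> C"
  shows "slope_sup f D \<le> C"
  unfolding slope_sup_def using assms by (intro cSup_least) auto

lemma slope_sup_add:
  fixes f g :: "('a, 'b) Lip"
  shows "slope_sup (Lip_fun (f + g)) D \<le> slope_sup (Lip_fun f) D + slope_sup (Lip_fun g) D"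
proof (rule slope_sup_least)
  fix x y :: 'a
  assume xy: "(x, y) \<in> D"
  have "norm (Lip_fun (f + g) x - Lip_fun (f + g) y) / dist x y
      \<le> (norm (Lip_fun f x - Lip_fun f y) + norm (Lip_fun g x - Lip_fun g y)) / dist x y"
    unfolding plus_Lip.rep_eq
    by (intro divide_right_mono) (auto simp: norm_diff_triangle_ineq)
  also have "\<dots> \<le> slope_sup (Lip_fun f) D + slope_sup (Lip_fun g) D"
    using slope_sup_upper[OF xy, of f] slope_sup_upper[OF xy, of g] by (simp add: add_divide_distrib)
  finally show "norm (Lip_fun (f + g) x - Lip_fun (f + g) y) / dist x y
      \<le> slope_sup (Lip_fun f) D + slope_sup (Lip_fun g) D" .
qed (intro add_nonneg_nonneg slope_sup_nonneg)

lemma slope_sup_scaleR_le: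
  fixes f :: "('a, 'b) Lip"
  shows "slope_sup (Lip_fun (c *\<^sub>R f)) D \<le> \<bar>c\<bar> * slope_sup (Lip_fun f) D"
proof (rule slope_sup_least)
  fix x y :: 'a
  assume xy: "(x, y) \<in> D"
  have "norm (Lip_fun (c *\<^sub>R f) x - Lip_fun (c *\<^sub>R f) y) / dist x y
      = \<bar>c\<bar> * (norm (Lip_fun f x - Lip_fun f y) / dist x y)"
    unfolding scaleR_Lip.rep_eq by (simp flip: scaleR_right_diff_distrib)
  then show "norm (Lip_fun (c *\<^sub>R f) x - Lip_fun (c *\<^sub>R f) y) / dist x y
      \<le> \<bar>c\<bar> * slope_sup (Lip_fun f) D"
    using mult_left_mono[OF slope_sup_upper[OF xy, of f], of "\<bar>c\<bar>"] by linarith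
qed (simp add: slope_sup_nonneg)

lemma Lip_norm_bound:
  fixes f :: "('a, 'b) Lip"
  shows "norm (Lip_fun f x - Lip_fun f y) \<le> norm f * dist x y"
proof (cases "x = y")
  case False
  then show ?thesis
    using slope_sup_upper[of x y "{(x, y). x \<noteq> y}" f]
    by (simp add: norm_Lip_def divide_le_eq)
qed simp

lemma Lip_fun_origin [simp]: "Lip_fun (f :: ('a, 'b) Lip) origin = 0"
  using Lip_fun[of f] by simp

lemma Lip_norm_bound_origin: "norm (Lip_fun (f :: ('a, 'b) Lip) x) \<le> norm f * dist x origin"
  using Lip_norm_bound[of f x origin] by simp

lemma Lip_norm_leI:
  fixes f :: "('a, 'b) Lip"
  assumes "0 \<le> C" "\<And>x y. norm (Lip_fun f x - Lip_fun f y) \<le> C * dist x y"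
  shows "norm f \<le> C"
  unfolding norm_Lip_def
  by (rule slope_sup_least) (use assms in \<open>auto simp: divide_le_eq\<close>)

instance
proof
  fix f g :: "('a, 'b) Lip" and a :: real
  show "dist f g = norm (f - g)" by (rule dist_Lip_def)
  show "sgn f = f /\<^sub>R norm f" by (rule sgn_Lip_def)
  show "uniformity = (INF e\<in>{0<..}. principal {(f :: ('a, 'b) Lip, g). dist f g < e})"
    by (rule uniformity_Lip_def)
  show "open U = (\<forall>f\<in>U. eventually (\<lambda>(f', g). f' = f \<longrightarrow> g \<in> U) uniformity)"
    for U :: "('a, 'b) Lip set" by (rule open_Lip_def)
  show "norm (f + g) \<le> norm f + norm g"
    unfolding norm_Lip_def by (rule slope_sup_add)
  show "norm f = 0 \<longleftrightarrow> f = 0"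
  proof
    assume "norm f = 0"
    then have "Lip_fun f x = 0" for x
      using Lip_norm_bound_origin[of f x] by simp
    then show "f = 0"
      by (metis Lip_fun_inject ext zero_Lip.rep_eq)
  next
    assume "f = 0"
    then have "norm f \<le> 0"
      by (intro Lip_norm_leI) (simp_all add: zero_Lip.rep_eq)
    then show "norm f = 0"
      using slope_sup_nonneg[of f] by (simp add: norm_Lip_def order_antisym)
  qed
  show "norm (a *\<^sub>R f) = \<bar>a\<bar> * norm f"
  proof (cases "a = 0")
    case True
    then have "norm (a *\<^sub>R f) \<le> 0"
      by (intro Lip_norm_leI) (simp_all add: scaleR_Lip.rep_eq zero_Lip.rep_eq)
    then show ?thesis
      using slope_sup_nonneg[of "a *\<^sub>R f"] True by (simp add: norm_Lip_def order_antisym)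
  next
    case False
    have "inverse a *\<^sub>R a *\<^sub>R f = f"
      using False by transfer simp
    then have "norm f \<le> \<bar>inverse a\<bar> * norm (a *\<^sub>R f)"
      using slope_sup_scaleR_le[of "inverse a" "a *\<^sub>R f"] by (simp add: norm_Lip_def)
    then have "\<bar>a\<bar> * norm f \<le> norm (a *\<^sub>R f)"
      using False by (simp add: field_simps)
    moreover have "norm (a *\<^sub>R f) \<le> \<bar>a\<bar> * norm f"
      unfolding norm_Lip_def by (rule slope_sup_scaleR_le)
    ultimately show ?thesis by simp
  qed
qed

end

instance Lip :: (pointed_metric_space, banach) banach
proof
  fix X :: "nat \<Rightarrow> ('a, 'b) Lip"
  assume X: "Cauchy X"
  have conv: "convergent (\<lambda>n. Lip_fun (X n) x)" for x
  proof (rule Cauchy_convergent, rule metric_CauchyI)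
    fix e :: real
    assume "0 < e"
    then have "0 < e / (dist x origin + 1)" by (simp add: add_nonneg_pos)
    then obtain N where N: "\<And>m n. m \<ge> N \<Longrightarrow> n \<ge> N \<Longrightarrow> dist (X m) (X n) < e / (dist x origin + 1)"
      using metric_CauchyD[OF X] by blast
    have "dist (Lip_fun (X m) x) (Lip_fun (X n) x) < e" if "m \<ge> N" "n \<ge> N" for m n
    proof -
      have "dist (Lip_fun (X m) x) (Lip_fun (X n) x) \<le> norm (X m - X n) * dist x origin"
        using Lip_norm_bound_origin[of "X m - X n" x] by (simp add: dist_norm minus_Lip.rep_eq)
      also have "\<dots> \<le> norm (X m - X n) * (dist x origin + 1)"
        by (intro mult_left_mono) auto
      also have "\<dots> < e"
        using N[OF that] by (simp add: dist_norm pos_less_divide_eq add_nonneg_pos)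
      finally show ?thesis .
    qed
    then show "\<exists>N. \<forall>m\<ge>N. \<forall>n\<ge>N. dist (Lip_fun (X m) x) (Lip_fun (X n) x) < e" by blast
  qed
  define F where "F = (\<lambda>x. lim (\<lambda>n. Lip_fun (X n) x))"
  have F: "(\<lambda>n. Lip_fun (X n) x) \<longlonglongrightarrow> F x" for x
    using conv[of x] by (simp add: F_def convergent_LIMSEQ_iff)
  have close: "\<exists>N. \<forall>n\<ge>N. \<forall>x y. norm ((Lip_fun (X n) x - F x) - (Lip_fun (X n) y - F y)) \<le> e * dist x y"
    if e: "0 < e" for e
  proof -
    obtain N where N: "\<And>m n. m \<ge> N \<Longrightarrow> n \<ge> N \<Longrightarrow> dist (X m) (X n) < e"
      using metric_CauchyD[OF X e] by blast
    have "norm ((Lip_fun (X n) x - F x) - (Lip_fun (X n) y - F y)) \<le> e * dist x y"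
      if n: "n \<ge> N" for n x y
    proof (rule LIMSEQ_le_const2)
      show "(\<lambda>m. norm ((Lip_fun (X n) x - Lip_fun (X m) x) - (Lip_fun (X n) y - Lip_fun (X m) y)))
          \<longlonglongrightarrow> norm ((Lip_fun (X n) x - F x) - (Lip_fun (X n) y - F y))"
        by (intro tendsto_intros F)
      have "norm ((Lip_fun (X n) x - Lip_fun (X m) x) - (Lip_fun (X n) y - Lip_fun (X m) y)) \<le> e * dist x y"
        if "m \<ge> N" for m
      proof -
        have "norm (X n - X m) * dist x y \<le> e * dist x y"
          using N[OF n that] by (intro mult_right_mono) (auto simp: dist_norm)
        then show ?thesis
          using Lip_norm_bound[of "X n - X m" x y] by (simp add: minus_Lip.rep_eq)
      qed
      then show "\<exists>N. \<forall>m\<ge>N. norm ((Lip_fun (X n) x - Lip_fun (X m) x)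
          - (Lip_fun (X n) y - Lip_fun (X m) y)) \<le> e * dist x y" by blast
    qed
    then show ?thesis by blast
  qed
  have "F origin = 0"
    using F[of origin] by (simp add: LIMSEQ_const_iff)
  moreover have "\<exists>C. C-lipschitz_on UNIV F"
  proof -
    obtain N where N: "\<And>x y. norm ((Lip_fun (X N) x - F x) - (Lip_fun (X N) y - F y)) \<le> 1 * dist x y"
      using close[of 1] by auto
    have "norm (F x - F y) \<le> (norm (X N) + 1) * dist x y" for x y
    proof -
      have "F x - F y = (Lip_fun (X N) x - Lip_fun (X N) y)
          - ((Lip_fun (X N) x - F x) - (Lip_fun (X N) y - F y))" by simp
      then have "norm (F x - F y) \<le> norm (Lip_fun (X N) x - Lip_fun (X N) y)
          + norm ((Lip_fun (X N) x - F x) - (Lip_fun (X N) y - F y))"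
        by (metis norm_triangle_ineq4)
      then show ?thesis
        using Lip_norm_bound[of "X N" x y] N[of x y] by (simp add: algebra_simps)
    qed
    then show ?thesis
      by (intro exI[of _ "norm (X N) + 1"] lipschitz_onI) (auto simp: dist_norm)
  qed
  ultimately have L: "Lip_fun (Lip F) = F"
    by (simp add: Lip_inverse)
  have "X \<longlonglongrightarrow> Lip F"
  proof (rule LIMSEQ_I)
    fix r :: real
    assume r: "0 < r"
    obtain N where N: "\<And>n x y. n \<ge> N \<Longrightarrow>
        norm ((Lip_fun (X n) x - F x) - (Lip_fun (X n) y - F y)) \<le> r / 2 * dist x y"
      using close[of "r / 2"] r by auto
    have "norm (X n - Lip F) < r" if "n \<ge> N" for n
    proof -
      have "norm (X n - Lip F) \<le> r / 2"
        using N[OF that] r by (intro Lip_norm_leI) (auto simp: minus_Lip.rep_eq L)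
      then show ?thesis using r by simp
    qed
    then show "\<exists>N. \<forall>n\<ge>N. norm (X n - Lip F) < r" by blast
  qed
  then show "convergent X" by (rule convergentI)
qed

definition lip_space :: "('m::pointed_metric_space, 'x::real_normed_vector) Lip set"
  where "lip_space = {f.
    ((\<lambda>\<epsilon>. slope_sup (Lip_fun f) {(x, y). 0 < dist x y \<and> dist x y < \<epsilon>}) \<longlongrightarrow> 0) (at_right 0)}"

definition S_space :: "('m::pointed_metric_space, 'x::real_normed_vector) Lip set"
  where "S_space = {f \<in> lip_space.
    ((\<lambda>r. slope_sup (Lip_fun f) {(x, y). x \<noteq> y \<and> (x \<notin> ball origin r \<or> y \<notin> ball origin r)})
      \<longlongrightarrow> 0) at_top}"

text \<open>
  Both spaces are closed subspaces, so over a Banach space \<open>'x\<close> they are Banach spaces under the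
  inherited norm.
\<close>

lemma slope_sup_le_norm:
  fixes f :: "('m::pointed_metric_space, 'x::real_normed_vector) Lip"
  shows "slope_sup (Lip_fun f) D \<le> norm f"
proof (rule slope_sup_least)
  fix x y :: 'm
  show "norm (Lip_fun f x - Lip_fun f y) / dist x y \<le> norm f"
    using Lip_norm_bound[of f x y] by (cases "x = y") (auto simp: divide_le_eq)
qed simp

lemma slope_vanishing:
  fixes D :: "'i \<Rightarrow> ('m::pointed_metric_space \<times> 'm) set" and \<F> :: "'i filter"
  defines "V \<equiv> {f :: ('m, 'x::real_normed_vector) Lip. ((\<lambda>i. slope_sup (Lip_fun f) (D i)) \<longlongrightarrow> 0) \<F>}"
  shows "subspace V" and "closed V"
proof -
  show "subspace V"
  proof (rule subspaceI)
    have "slope_sup (Lip_fun (0 :: ('m, 'x) Lip)) E = 0" for E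
      using slope_sup_le_norm[of "0 :: ('m, 'x) Lip" E] slope_sup_nonneg[of "0 :: ('m, 'x) Lip" E]
      by (simp add: order_antisym)
    then show "0 \<in> V" by (simp add: V_def)
  next
    fix f g
    assume "f \<in> V" "g \<in> V"
    then have *: "((\<lambda>i. slope_sup (Lip_fun f) (D i) + slope_sup (Lip_fun g) (D i)) \<longlongrightarrow> 0) \<F>"
      by (auto simp: V_def intro: tendsto_add_zero)
    show "f + g \<in> V"
      unfolding V_def mem_Collect_eq
      by (rule tendsto_sandwich[OF _ _ tendsto_const *])
        (simp_all add: slope_sup_nonneg slope_sup_add)
  next
    fix c f
    assume "f \<in> V"
    then have *: "((\<lambda>i. \<bar>c\<bar> * slope_sup (Lip_fun f) (D i)) \<longlongrightarrow> 0) \<F>"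
      by (auto simp: V_def intro: tendsto_mult_right_zero)
    show "c *\<^sub>R f \<in> V"
      unfolding V_def mem_Collect_eq
      by (rule tendsto_sandwich[OF _ _ tendsto_const *])
        (simp_all add: slope_sup_nonneg slope_sup_scaleR_le)
  qed
  show "closed V"
    unfolding closed_sequential_limits
  proof (intro allI impI, elim conjE)
    fix X f
    assume X: "\<forall>n. X n \<in> V" and lim: "X \<longlonglongrightarrow> f"
    have "\<forall>\<^sub>F i in \<F>. dist (slope_sup (Lip_fun f) (D i)) 0 < e" if e: "0 < e" for e
    proof -
      obtain n where n: "norm (f - X n) < e / 2"
        using LIMSEQ_D[OF lim, of "e / 2"] e by (auto simp: norm_minus_commute)
      have "\<forall>\<^sub>F i in \<F>. dist (slope_sup (Lip_fun (X n)) (D i)) 0 < e / 2"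
        using X e unfolding V_def by (intro tendstoD) auto
      then show ?thesis
      proof eventually_elim
        case (elim i)
        have "slope_sup (Lip_fun f) (D i)
            \<le> slope_sup (Lip_fun (X n)) (D i) + slope_sup (Lip_fun (f - X n)) (D i)"
          using slope_sup_add[of "X n" "f - X n" "D i"] by simp
        also have "\<dots> < e"
          using elim n slope_sup_le_norm[of "f - X n" "D i"] by (simp add: dist_real_def)
        finally show ?case
          by (simp add: dist_real_def slope_sup_nonneg)
      qed
    qed
    then show "f \<in> V"
      by (auto simp: V_def tendsto_iff)
  qed
qed

lemma subspace_lip_space: "subspace lip_space"
  and closed_lip_space: "closed lip_space"
  unfolding lip_space_def by (rule slope_vanishing)+

lemma S_space_eq_Int: "S_space = lip_space \<inter> {f.
    ((\<lambda>r. slope_sup (Lip_fun f) {(x, y). x \<noteq> y \<and> (x \<notin> ball origin r \<or> y \<notin> ball origin r)})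
      \<longlongrightarrow> 0) at_top}"
  by (auto simp: S_space_def)

lemma subspace_S_space: "subspace S_space"
  unfolding S_space_eq_Int by (intro subspace_inter subspace_lip_space slope_vanishing)

lemma closed_S_space: "closed S_space"
  unfolding S_space_eq_Int by (intro closed_Int closed_lip_space slope_vanishing)


section \<open>Properties of Banach spaces\<close>

text \<open>
  The Banach spaces in question are closed subspaces of an ambient normed space, so the following
  notions are stated for a subspace given as a set.
\<close>

definition infinite_dimensional :: "'z::real_vector set \<Rightarrow> bool"
  where "infinite_dimensional Z \<longleftrightarrow> \<not> (\<exists>B. finite B \<and> span B = Z)"

text \<open>
  The family \<open>{x\<^sub>\<gamma>}\<^sub>\<gamma>\<close> is a set \<open>A\<close> indexed by itself. Families with repetitions give the same notion:
  for \<open>\<epsilon> < 1\<close> the second condition excludes \<open>x\<^sub>\<gamma> = x\<^sub>\<gamma>\<^sub>'\<close> with \<open>\<gamma> \<noteq> \<gamma>'\<close>, and a family for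
  a smaller \<open>\<epsilon>\<close> also serves a larger one.
\<close>

definition UASQ :: "'z::real_normed_vector set \<Rightarrow> bool"
  where "UASQ Z \<longleftrightarrow> (\<forall>\<epsilon>>0. \<exists>A. A \<subseteq> Z \<inter> sphere 0 1 \<and>
    (\<forall>Y \<delta>. finite Y \<and> Y \<subseteq> Z \<inter> sphere 0 1 \<and> 0 < \<delta> \<longrightarrow>
      (\<exists>x\<in>A. \<forall>y\<in>Y. norm (y + x) \<le> 1 + \<delta> \<and> norm (y - x) \<le> 1 + \<delta>)) \<and>
    (\<forall>F \<xi>. finite F \<and> F \<subseteq> A \<and> (\<forall>x\<in>F. \<xi> x \<in> {-1, 1 :: real}) \<longrightarrow>
      norm (\<Sum>x\<in>F. \<xi> x *\<^sub>R x) \<le> 1 + \<epsilon>))"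

definition isometrically_isomorphic ::
    "'v::real_normed_vector set \<Rightarrow> 'w::real_normed_vector set \<Rightarrow> bool"
  where "isometrically_isomorphic V W \<longleftrightarrow> (\<exists>T. bij_betw T V W \<and>
    (\<forall>x\<in>V. \<forall>y\<in>V. T (x + y) = T x + T y) \<and>
    (\<forall>c. \<forall>x\<in>V. T (c *\<^sub>R x) = c *\<^sub>R T x) \<and>
    (\<forall>x\<in>V. norm (T x) = norm x))"

end

theory Submission
  imports Defs
begin

text \<open>
  Two independent facts combine. The first is that \<open>S(M, X)\<close> behaves like an infinite-dimensional
  subspace of a \<open>c\<^sub>0\<close>-space. Assign to a Lipschitz function its difference quotients on the pairs
  of distinct points. Since \<open>M\<close> is proper, those pairs are exhausted by the relatively compact
  sets \<open>core_pairs n\<close>, on which the points stay near the origin and away from each other, and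
  membership in \<open>S(M, X)\<close> makes the quotients uniformly small off \<open>core_pairs n\<close> for large \<open>n\<close>
  (\<open>S_space_slopes_small_off_core\<close>). On the other hand, an infinite-dimensional \<open>S(M)\<close> contains
  unit vectors vanishing on any given finite set; a finite net of a ball then produces unit vectors
  with small quotients on \<open>core_pairs n\<close> (\<open>unit_function_slopes_small_on_core\<close>). Alternating
  the two facts gives unit functions whose slopes live essentially on disjoint sets of pairs
  (\<open>gliding_humps\<close>). Multiplying them by a fixed unit vector of \<open>X\<close> gives the family required for
  unconditional almost squareness: signed sums have norm at most \<open>1 + \<epsilon>\<close> as every pair
  meets at most one hump, and the far humps barely interact with finitely many given functions
  (\<open>S_space_UASQ\<close>).

  The second fact is that no dual space is UASQ (\<open>dual_not_UASQ\<close>). In a dual space the whole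
  family \<open>{x\<^sub>\<gamma>}\<close> has a weak* sum \<open>s\<close>, and \<open>s\<close> as well as every \<open>s - 2x\<^sub>\<gamma>\<close> has norm at most
  \<open>1 + \<epsilon>\<close>. This forces \<open>s\<close> to have norm close to \<open>1\<close> and \<open>s + x\<^sub>\<gamma>\<close> to have norm close to \<open>2\<close>
  for every \<open>\<gamma>\<close>, so almost squareness fails for the normalization of \<open>s\<close>: no
  \<open>x\<^sub>\<gamma>\<close> can be added to it without nearly doubling the norm.

  For compact \<open>M\<close> the condition at infinity is void, and \<open>lip(M, X)\<close> coincides with \<open>S(M, X)\<close>.
\<close>

section \<open>Dual spaces are not unconditionally almost square\<close>

lemma isometry_on_subspace_sum:
  fixes T :: "'v::real_normed_vector \<Rightarrow> 'w::real_normed_vector"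
  assumes Z: "subspace Z"
    and add: "\<And>x y. x \<in> Z \<Longrightarrow> y \<in> Z \<Longrightarrow> T (x + y) = T x + T y"
    and scale: "\<And>c x. x \<in> Z \<Longrightarrow> T (c *\<^sub>R x) = c *\<^sub>R T x"
    and F: "finite F" "F \<subseteq> Z"
  shows "T (\<Sum>x\<in>F. c x *\<^sub>R x) = (\<Sum>x\<in>F. c x *\<^sub>R T x)"
  using F
proof (induction F rule: finite_induct)
  case empty
  then show ?case using scale[OF subspace_0[OF Z], of 0] by simp
next
  case (insert a F)
  have "(\<Sum>x\<in>F. c x *\<^sub>R x) \<in> Z" "c a *\<^sub>R a \<in> Z"
    using insert.prems by (auto intro!: subspace_sum[OF Z] subspace_scale[OF Z])
  then show ?case using insert by (simp add: add scale)
qed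

lemma UASQ_isometrically_isomorphic:
  fixes Z :: "'v::real_normed_vector set" and W :: "'w::real_normed_vector set"
  assumes Z: "subspace Z" and UASQ: "UASQ Z" and iso: "isometrically_isomorphic Z W"
  shows "UASQ W"
  unfolding UASQ_def
proof (intro allI impI)
  fix \<epsilon> :: real
  assume "0 < \<epsilon>"
  then obtain A where A: "A \<subseteq> Z \<inter> sphere 0 1"
    and square: "\<And>Y \<delta>. finite Y \<Longrightarrow> Y \<subseteq> Z \<inter> sphere 0 1 \<Longrightarrow> 0 < \<delta> \<Longrightarrow>
      \<exists>x\<in>A. \<forall>y\<in>Y. norm (y + x) \<le> 1 + \<delta> \<and> norm (y - x) \<le> 1 + \<delta>"
    and uncond: "\<And>F \<xi>. finite F \<Longrightarrow> F \<subseteq> A \<Longrightarrow> (\<forall>x\<in>F. \<xi> x \<in> {-1, 1 :: real}) \<Longrightarrow>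
      norm (\<Sum>x\<in>F. \<xi> x *\<^sub>R x) \<le> 1 + \<epsilon>"
    using UASQ unfolding UASQ_def by (smt (verit, best))
  obtain T where bij: "bij_betw T Z W"
    and add: "\<And>x y. x \<in> Z \<Longrightarrow> y \<in> Z \<Longrightarrow> T (x + y) = T x + T y"
    and scale: "\<And>c x. x \<in> Z \<Longrightarrow> T (c *\<^sub>R x) = c *\<^sub>R T x"
    and norm: "\<And>x. x \<in> Z \<Longrightarrow> norm (T x) = norm x"
    using iso unfolding isometrically_isomorphic_def by blast
  have diff: "T (x - y) = T x - T y" if "x \<in> Z" "y \<in> Z" for x y
    using add[of x "-1 *\<^sub>R y"] scale[of y "-1"] subspace_scale[OF Z, of y "-1"] that by simp
  have TZ: "T ` Z = W" and inj: "inj_on T Z"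
    using bij by (auto simp: bij_betw_def)
  have AZ: "A \<subseteq> Z" using A by blast
  show "\<exists>A. A \<subseteq> W \<inter> sphere 0 1 \<and>
    (\<forall>Y \<delta>. finite Y \<and> Y \<subseteq> W \<inter> sphere 0 1 \<and> 0 < \<delta> \<longrightarrow>
      (\<exists>x\<in>A. \<forall>y\<in>Y. norm (y + x) \<le> 1 + \<delta> \<and> norm (y - x) \<le> 1 + \<delta>)) \<and>
    (\<forall>F \<xi>. finite F \<and> F \<subseteq> A \<and> (\<forall>x\<in>F. \<xi> x \<in> {-1, 1 :: real}) \<longrightarrow>
      norm (\<Sum>x\<in>F. \<xi> x *\<^sub>R x) \<le> 1 + \<epsilon>)"
  proof (intro exI[of _ "T ` A"] conjI allI impI; (elim conjE)?)
    show "T ` A \<subseteq> W \<inter> sphere 0 1"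
      using A TZ norm by fastforce
  next
    fix Y and \<delta> :: real
    assume Y: "finite Y" "Y \<subseteq> W \<inter> sphere 0 1" and \<delta>: "0 < \<delta>"
    obtain Y' where Y': "Y' \<subseteq> Z" "finite Y'" "Y = T ` Y'"
      using finite_subset_image[of Y T Z] Y TZ by blast
    then have "Y' \<subseteq> Z \<inter> sphere 0 1"
      using Y norm by fastforce
    then obtain x where x: "x \<in> A"
      "\<forall>y\<in>Y'. norm (y + x) \<le> 1 + \<delta> \<and> norm (y - x) \<le> 1 + \<delta>"
      using square[OF Y'(2) _ \<delta>] by blast
    have "norm (T y + T x) = norm (y + x) \<and> norm (T y - T x) = norm (y - x)" if "y \<in> Y'" for y
      using that x(1) Y'(1) AZ subspace_add[OF Z, of y x] subspace_diff[OF Z, of y x]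
      by (metis add diff norm subsetD)
    then show "\<exists>x\<in>T ` A. \<forall>y\<in>Y. norm (y + x) \<le> 1 + \<delta> \<and> norm (y - x) \<le> 1 + \<delta>"
      unfolding Y'(3) using x by (metis (no_types, lifting) imageE imageI)
  next
    fix F and \<xi> :: "'w \<Rightarrow> real"
    assume F: "finite F" "F \<subseteq> T ` A" and \<xi>: "\<forall>x\<in>F. \<xi> x \<in> {-1, 1}"
    obtain F' where F': "F' \<subseteq> A" "finite F'" "F = T ` F'"
      using finite_subset_image[OF F] by blast
    have F'Z: "F' \<subseteq> Z" using F'(1) AZ by blast
    have "(\<Sum>x\<in>F. \<xi> x *\<^sub>R x) = (\<Sum>x\<in>F'. \<xi> (T x) *\<^sub>R T x)"
      using F'(3) inj_on_subset[OF inj F'Z] by (simp add: sum.reindex)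
    also have "\<dots> = T (\<Sum>x\<in>F'. \<xi> (T x) *\<^sub>R x)"
      using isometry_on_subspace_sum[OF Z add scale F'(2) F'Z] by metis
    also have "norm \<dots> = norm (\<Sum>x\<in>F'. \<xi> (T x) *\<^sub>R x)"
      using F'Z by (intro norm subspace_sum[OF Z] subspace_scale[OF Z]) auto
    also have "\<dots> \<le> 1 + \<epsilon>"
      using \<xi> F' by (intro uncond) auto
    finally show "norm (\<Sum>x\<in>F. \<xi> x *\<^sub>R x) \<le> 1 + \<epsilon>" .
  qed
qed

text \<open>
  For a vector \<open>b\<close> of the predual, choosing the signs of the numbers \<open>a(b)\<close> bounds
  \<open>\<Sum>\<^sub>a \<bar>a(b)\<bar>\<close> by \<open>C \<parallel>b\<parallel>\<close>, so the family is weak* summable, and every change of signs in the sum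
  is controlled by the same bound. Only the change of a single sign, which turns \<open>s\<close> into
  \<open>s - 2a\<close>, is recorded.
\<close>

lemma weak_star_unconditional_sum:
  fixes A :: "('b::real_normed_vector \<Rightarrow>\<^sub>L real) set"
  assumes uncond: "\<And>F \<xi>. finite F \<Longrightarrow> F \<subseteq> A \<Longrightarrow> (\<forall>x\<in>F. \<xi> x \<in> {-1, 1 :: real}) \<Longrightarrow>
      norm (\<Sum>x\<in>F. \<xi> x *\<^sub>R x) \<le> C"
  obtains s where "norm s \<le> C" "\<And>a. a \<in> A \<Longrightarrow> norm (s - 2 *\<^sub>R a) \<le> C"
proof -
  have C: "0 \<le> C"
    using uncond[of "{}"] by simp
  have fin: "(\<Sum>a\<in>F. \<bar>blinfun_apply a b\<bar>) \<le> C * norm b" if F: "finite F" "F \<subseteq> A"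
    for F and b :: 'b
  proof -
    define \<xi> where "\<xi> a = (if 0 \<le> blinfun_apply a b then 1 else -1 :: real)" for a :: "'b \<Rightarrow>\<^sub>L real"
    have "(\<Sum>a\<in>F. \<bar>blinfun_apply a b\<bar>) = (\<Sum>a\<in>F. \<xi> a * blinfun_apply a b)"
      by (intro sum.cong) (auto simp: \<xi>_def)
    also have "\<dots> = blinfun_apply (\<Sum>a\<in>F. \<xi> a *\<^sub>R a) b"
      by (simp add: blinfun.sum_left blinfun.scaleR_left)
    also have "\<dots> \<le> norm (\<Sum>a\<in>F. \<xi> a *\<^sub>R a) * norm b"
      using norm_blinfun[of "\<Sum>a\<in>F. \<xi> a *\<^sub>R a" b] by simp
    also have "\<dots> \<le> C * norm b"
      using F by (intro mult_right_mono uncond) (auto simp: \<xi>_def)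
    finally show ?thesis .
  qed
  have abs: "(\<lambda>a. \<bar>blinfun_apply a b\<bar>) summable_on A" for b
    by (rule nonneg_bdd_above_summable_on) (auto intro!: bdd_aboveI2 fin)
  have summable: "(\<lambda>a. blinfun_apply a b) summable_on A" for b
    by (rule abs_summable_summable) (use abs in simp)
  have abs_le: "(\<Sum>\<^sub>\<infinity>a\<in>A. \<bar>blinfun_apply a b\<bar>) \<le> C * norm b" for b
    by (rule infsum_le_finite_sums[OF abs fin])
  have le_abs: "\<bar>\<Sum>\<^sub>\<infinity>a\<in>A'. blinfun_apply a b\<bar> \<le> (\<Sum>\<^sub>\<infinity>a\<in>A'. \<bar>blinfun_apply a b\<bar>)"
    if "A' \<subseteq> A" for A' b
    using norm_infsum_bound[of "\<lambda>a. blinfun_apply a b" A'] summable_on_subset_banach[OF abs that]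
    by simp
  define s where "s = Blinfun (\<lambda>b. \<Sum>\<^sub>\<infinity>a\<in>A. blinfun_apply a b)"
  have "bounded_linear (\<lambda>b. \<Sum>\<^sub>\<infinity>a\<in>A. blinfun_apply a b)"
  proof (rule bounded_linear_intro[of _ C])
    fix b c :: 'b and r :: real
    show "(\<Sum>\<^sub>\<infinity>a\<in>A. blinfun_apply a (b + c))
        = (\<Sum>\<^sub>\<infinity>a\<in>A. blinfun_apply a b) + (\<Sum>\<^sub>\<infinity>a\<in>A. blinfun_apply a c)"
      by (simp add: blinfun.add_right infsum_add[OF summable summable])
    show "(\<Sum>\<^sub>\<infinity>a\<in>A. blinfun_apply a (r *\<^sub>R b)) = r *\<^sub>R (\<Sum>\<^sub>\<infinity>a\<in>A. blinfun_apply a b)"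
      by (simp add: blinfun.scaleR_right infsum_cmult_right')
    show "norm (\<Sum>\<^sub>\<infinity>a\<in>A. blinfun_apply a b) \<le> norm b * C"
      using le_abs[OF order_refl, of b] abs_le[of b] by (simp add: mult.commute)
  qed
  then have s: "blinfun_apply s b = (\<Sum>\<^sub>\<infinity>a\<in>A. blinfun_apply a b)" for b
    by (simp add: s_def bounded_linear_Blinfun_apply)
  show ?thesis
  proof
    show "norm s \<le> C"
      using le_abs[OF order_refl] abs_le C
      by (intro norm_blinfun_bound) (auto simp: s intro: order_trans)
    fix a
    assume a: "a \<in> A"
    have "\<bar>blinfun_apply (s - 2 *\<^sub>R a) b\<bar> \<le> C * norm b" for b
    proof -
      have split: "infsum f A = infsum f (A - {a}) + f a" if "f summable_on A"
        for f :: "('b \<Rightarrow>\<^sub>L real) \<Rightarrow> real"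
        using infsum_Un_disjoint[of f "A - {a}" "{a}"] summable_on_subset_banach[OF that, of "A - {a}"] a
        by (simp add: insert_absorb)
      have "blinfun_apply (s - 2 *\<^sub>R a) b
          = (\<Sum>\<^sub>\<infinity>a\<in>A - {a}. blinfun_apply a b) - blinfun_apply a b"
        using split[OF summable, of b] by (simp add: blinfun.diff_left blinfun.scaleR_left s)
      also have "\<bar>\<dots>\<bar> \<le> (\<Sum>\<^sub>\<infinity>a\<in>A. \<bar>blinfun_apply a b\<bar>)"
        using split[OF abs, of b] le_abs[of "A - {a}" b] by simp
      finally show ?thesis using abs_le[of b] by simp
    qed
    then show "norm (s - 2 *\<^sub>R a) \<le> C"
      using C by (intro norm_blinfun_bound) auto
  qed
qed

text \<open>
  The constant \<open>1 / 4\<close> serves for both \<open>\<epsilon>\<close> and \<open>\<delta>\<close>: the weak* sum \<open>s\<close> satisfies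
  \<open>\<parallel>s + a\<parallel> \<ge> 4 - 1 - 5 / 4 = 7 / 4\<close> for all \<open>a\<close> of the family. But
  \<open>y = s / \<parallel>s\<parallel>\<close> is within \<open>1 / 4\<close> of \<open>s\<close>, and almost squareness provides an \<open>a\<close> with
  \<open>\<parallel>y + a\<parallel> \<le> 5 / 4\<close>, so that \<open>\<parallel>s + a\<parallel> \<le> 3 / 2\<close>.
\<close>

lemma dual_not_UASQ: "\<not> UASQ (UNIV :: ('b::real_normed_vector \<Rightarrow>\<^sub>L real) set)"
proof
  assume "UASQ (UNIV :: ('b \<Rightarrow>\<^sub>L real) set)"
  moreover have "(0::real) < 1 / 4" by simp
  ultimately obtain A :: "('b \<Rightarrow>\<^sub>L real) set" where A: "A \<subseteq> sphere 0 1"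
    and square: "\<And>Y \<delta>. finite Y \<Longrightarrow> Y \<subseteq> sphere 0 1 \<Longrightarrow> 0 < \<delta> \<Longrightarrow>
      \<exists>x\<in>A. \<forall>y\<in>Y. norm (y + x) \<le> 1 + \<delta> \<and> norm (y - x) \<le> 1 + \<delta>"
    and uncond: "\<And>F \<xi>. finite F \<Longrightarrow> F \<subseteq> A \<Longrightarrow> (\<forall>x\<in>F. \<xi> x \<in> {-1, 1 :: real}) \<Longrightarrow>
      norm (\<Sum>x\<in>F. \<xi> x *\<^sub>R x) \<le> 1 + 1 / 4"
    unfolding UASQ_def Int_UNIV_left by (smt (verit, best))
  obtain s where s: "norm s \<le> 5 / 4" "\<And>a. a \<in> A \<Longrightarrow> norm (s - 2 *\<^sub>R a) \<le> 5 / 4"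
    using weak_star_unconditional_sum[OF uncond] by auto
  have large: "7 / 4 \<le> norm (s + a)" if "a \<in> A" for a
  proof -
    have "4 *\<^sub>R a = 2 *\<^sub>R (2 *\<^sub>R a)" by simp
    also have "\<dots> = (s + a) + a - (s - 2 *\<^sub>R a)"
      by (simp add: scaleR_2 del: scaleR_scaleR)
    finally have "norm (4 *\<^sub>R a) \<le> norm (s + a) + norm a + norm (s - 2 *\<^sub>R a)"
      using norm_triangle_ineq[of "s + a" a] norm_triangle_ineq4[of "s + a + a" "s - 2 *\<^sub>R a"]
      by (simp only:)
    moreover have "norm a = 1" using A that by auto
    ultimately show ?thesis using s(2)[OF that] by simp
  qed
  obtain a0 where "a0 \<in> A"
    using square[of "{}" 1] by auto
  then have lower: "3 / 4 \<le> norm s"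
    using large[of a0] norm_triangle_ineq[of s a0] A by force
  define y where "y = s /\<^sub>R norm s"
  have "norm s \<noteq> 0"
    using lower by linarith
  then have y: "norm y = 1" "s - y = (norm s - 1) *\<^sub>R y"
    by (auto simp: y_def left_diff_distrib scaleR_left_diff_distrib)
  then obtain a where a: "a \<in> A" "norm (y + a) \<le> 1 + 1 / 4"
    using square[of "{y}" "1 / 4"] by auto
  have "norm (s - y) = \<bar>norm s - 1\<bar>"
    using y by simp
  then have "norm (s - y) \<le> 1 / 4"
    using lower s(1) by linarith
  then have "norm (s + a) \<le> 1 + 1 / 4 + 1 / 4"
    using norm_triangle_ineq[of "s - y" "y + a"] a(2) by simp
  then show False
    using large[OF a(1)] by simp
qed

section \<open>Slopes over an exhaustion of the off-diagonal pairs\<close>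

text \<open>
  Closeness is measured by \<open>n * dist x y\<close> instead of \<open>1 / n\<close>, so that \<open>n = 0\<close> gives the empty
  set and the diagonal is always excluded.
\<close>

definition core_pairs :: "nat \<Rightarrow> ('m::pointed_metric_space \<times> 'm) set"
  where "core_pairs n = {(x, y). x \<in> ball origin n \<and> y \<in> ball origin n \<and> 1 \<le> n * dist x y}"

lemma core_pairs_mono: "m \<le> n \<Longrightarrow> core_pairs m \<subseteq> core_pairs n"
  by (auto simp: core_pairs_def intro: order_trans[OF _ mult_right_mono])

text \<open>
  A pair off \<open>core_pairs n\<close> consists of points that are close together, where the little Lipschitz
  condition applies, or has a point far from the origin, where the condition at infinity applies.
\<close>

lemma S_space_slopes_small_off_core:
  fixes f :: "('m::pointed_metric_space, 'x::real_normed_vector) Lip"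
  assumes f: "f \<in> S_space" and e: "0 < e"
  shows "\<forall>\<^sub>F n in sequentially. \<forall>x y. (x, y) \<notin> core_pairs n \<longrightarrow>
    norm (Lip_fun f x - Lip_fun f y) \<le> e * dist x y"
proof -
  let ?near = "\<lambda>\<epsilon>. {(x :: 'm, y). 0 < dist x y \<and> dist x y < \<epsilon>}"
  let ?far = "\<lambda>r. {(x :: 'm, y). x \<noteq> y \<and> (x \<notin> ball origin r \<or> y \<notin> ball origin r)}"
  have "\<forall>\<^sub>F \<epsilon> in at_right 0. slope_sup (Lip_fun f) (?near \<epsilon>) < e"
    using f e unfolding S_space_def lip_space_def by (auto intro: order_tendstoD)
  then have "\<forall>\<^sub>F \<epsilon> in at_right 0. 0 < \<epsilon> \<and> slope_sup (Lip_fun f) (?near \<epsilon>) < e"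
    using eventually_at_right_less by (rule eventually_conj[rotated])
  then obtain \<epsilon> where \<epsilon>: "0 < \<epsilon>" "slope_sup (Lip_fun f) (?near \<epsilon>) < e"
    using eventually_happens'[OF trivial_limit_at_right_real] by blast
  have "\<forall>\<^sub>F r in at_top. slope_sup (Lip_fun f) (?far r) < e"
    using f e unfolding S_space_def by (auto intro: order_tendstoD)
  then have "\<forall>\<^sub>F n in sequentially. slope_sup (Lip_fun f) (?far (real n)) < e"
    by (rule eventually_compose_filterlim[OF _ filterlim_real_sequentially])
  moreover have "\<forall>\<^sub>F n in sequentially. 1 / \<epsilon> < real n"
    using filterlim_real_sequentially by (simp add: filterlim_at_top_dense)
  ultimately show ?thesis
  proof eventually_elim
    case (elim n)
    have "norm (Lip_fun f x - Lip_fun f y) \<le> e * dist x y" if xy: "(x, y) \<notin> core_pairs n" for x y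
    proof (cases "x = y")
      case False
      have "dist x y < \<epsilon>" if "real n * dist x y < 1"
      proof -
        have "1 / \<epsilon> * dist x y < 1"
          using that elim(2) mult_right_mono[of "1 / \<epsilon>" "real n" "dist x y"] by simp
        then show ?thesis using \<epsilon>(1) by (simp add: field_simps)
      qed
      then have "(x, y) \<in> ?near \<epsilon> \<or> (x, y) \<in> ?far (real n)"
        using xy False by (auto simp: core_pairs_def not_le)
      then have "norm (Lip_fun f x - Lip_fun f y) / dist x y \<le> e"
        using slope_sup_upper[of x y _ f] \<epsilon>(2) elim(1) by (meson less_imp_le order_trans)
      then show ?thesis using False by (simp add: divide_le_eq)
    qed simp
    then show ?case by blast
  qed
qed

section \<open>Gliding humps\<close>

lemma infinite_dimensional_kernel:
  assumes Z: "subspace Z" and inf: "infinite_dimensional Z"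
    and \<phi>: "linear (\<phi> :: 'z::real_vector \<Rightarrow> real)"
  shows "infinite_dimensional {z \<in> Z. \<phi> z = 0}"
proof (cases "\<forall>z\<in>Z. \<phi> z = 0")
  case True
  then show ?thesis using inf by (simp add: Collect_conj_eq Int_absorb2 subsetI Collect_mem_eq)
next
  case False
  then obtain u where u: "u \<in> Z" "\<phi> u \<noteq> 0" by blast
  show ?thesis
    unfolding infinite_dimensional_def
  proof
    assume "\<exists>B. finite B \<and> span B = {z \<in> Z. \<phi> z = 0}"
    then obtain B where B: "finite B" "span B = {z \<in> Z. \<phi> z = 0}" by blast
    have "span (insert u B) = Z"
    proof
      have "B \<subseteq> Z" using B(2) span_superset by blast
      then show "span (insert u B) \<subseteq> Z"
        using u(1) Z by (intro span_minimal) auto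
      show "Z \<subseteq> span (insert u B)"
      proof
        fix z
        assume z: "z \<in> Z"
        have "z - (\<phi> z / \<phi> u) *\<^sub>R u \<in> span B"
          unfolding B(2) using z u Z \<phi>
          by (auto simp: linear_diff linear_cmul intro: subspace_diff subspace_scale)
        then show "z \<in> span (insert u B)"
          using span_insert by blast
      qed
    qed
    then show False
      using inf B(1) unfolding infinite_dimensional_def by blast
  qed
qed

lemma infinite_dimensional_vanishing_on_finite:
  fixes Z :: "('m::pointed_metric_space, real) Lip set"
  assumes Z: "subspace Z" "infinite_dimensional Z" and P: "finite P"
  shows "subspace {h \<in> Z. \<forall>p\<in>P. Lip_fun h p = 0} \<and>
    infinite_dimensional {h \<in> Z. \<forall>p\<in>P. Lip_fun h p = 0}"
  using P
proof (induction P rule: finite_induct)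
  case empty
  then show ?case using Z by simp
next
  case (insert p P)
  have eval: "linear (\<lambda>h :: ('m, real) Lip. Lip_fun h p)"
    by (rule linearI) (simp_all add: plus_Lip.rep_eq scaleR_Lip.rep_eq)
  have eq: "{h \<in> Z. \<forall>p\<in>insert p P. Lip_fun h p = 0}
      = {h \<in> {h \<in> Z. \<forall>p\<in>P. Lip_fun h p = 0}. Lip_fun h p = 0}"
    by auto
  show ?case
    unfolding eq
    using infinite_dimensional_kernel[OF insert.IH[THEN conjunct1] insert.IH[THEN conjunct2] eval]
      subspace_inter[OF insert.IH[THEN conjunct1] linear_subspace_kernel[OF eval]]
    by (simp add: Int_def)
qed

text \<open>
  A function of Lipschitz constant \<open>1\<close> that vanishes on a \<open>\<tau>\<close>-net of a ball is bounded by \<open>\<tau>\<close>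
  there, and on \<open>core_pairs n\<close> a bound on values is a bound on slopes up to the factor \<open>2n\<close>.
\<close>

lemma unit_function_slopes_small_on_core:
  assumes proper: "\<And>(x :: 'm::pointed_metric_space) r. compact (cball x r)"
    and inf: "infinite_dimensional (S_space :: ('m, real) Lip set)" and e: "0 < e"
  shows "\<exists>h \<in> S_space \<inter> sphere 0 1. \<forall>(x :: 'm, y) \<in> core_pairs n.
    \<bar>Lip_fun h x - Lip_fun h y\<bar> \<le> e * dist x y"
proof -
  \<comment> \<open>The summand \<open>1\<close> keeps the mesh meaningful for \<open>n = 0\<close>.\<close>
  define \<tau> where "\<tau> = e / (2 * (real n + 1))"
  have \<tau>: "0 < \<tau>" "2 * \<tau> * n \<le> e"
    using e by (auto simp: \<tau>_def field_simps)
  have "cball (origin :: 'm) n \<subseteq> (\<Union>p\<in>cball origin n. ball p \<tau>)"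
    using \<tau>(1) by (intro subsetI UN_I) auto
  then obtain P :: "'m set" where P: "finite P" "cball origin n \<subseteq> (\<Union>p\<in>P. ball p \<tau>)"
    using compactE_image[where f = "\<lambda>p. ball p \<tau>", OF proper open_ball] by metis
  let ?V = "{h \<in> S_space :: ('m, real) Lip set. \<forall>p\<in>P. Lip_fun h p = 0}"
  have V: "subspace ?V" "infinite_dimensional ?V"
    using infinite_dimensional_vanishing_on_finite[OF subspace_S_space inf P(1)] by auto
  have "?V \<noteq> {0}"
    using V(2) unfolding infinite_dimensional_def by (metis finite.emptyI span_empty)
  then obtain g where g: "g \<in> ?V" "g \<noteq> 0"
    using subspace_0[OF V(1)] by blast
  define h where "h = g /\<^sub>R norm g"
  have h: "h \<in> ?V" "norm h = 1"
    using subspace_scale[OF V(1) g(1), of "inverse (norm g)"] g(2) unfolding h_def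
    by (blast, simp)
  have small: "\<bar>Lip_fun h x\<bar> \<le> \<tau>" if x: "x \<in> ball origin n" for x
  proof -
    obtain p where p: "p \<in> P" "dist p x < \<tau>"
      using subsetD[OF P(2) subsetD[OF ball_subset_cball x]] by auto
    then show ?thesis
      using Lip_norm_bound[of h x p] h by (simp add: dist_commute)
  qed
  have "\<bar>Lip_fun h x - Lip_fun h y\<bar> \<le> e * dist x y" if "(x, y) \<in> core_pairs n" for x y
  proof -
    have "\<bar>Lip_fun h x - Lip_fun h y\<bar> \<le> 2 * \<tau> * 1"
      using small[of x] small[of y] that by (simp add: core_pairs_def)
    also have "\<dots> \<le> 2 * \<tau> * (n * dist x y)"
      using that \<tau>(1) by (intro mult_left_mono) (auto simp: core_pairs_def)
    also have "\<dots> \<le> e * dist x y"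
      using mult_right_mono[OF \<tau>(2), of "dist x y"] by (simp add: mult.assoc)
    finally show ?thesis .
  qed
  then show ?thesis using h by (intro bexI[of _ h]) auto
qed

text \<open>
  The slopes of \<open>h k\<close> are essentially carried by \<open>core_pairs (n k)\<close>, and those of \<open>h (Suc k)\<close> by
  the complement of \<open>core_pairs (n k)\<close>. The errors \<open>e k\<close> are left free so that they can be made
  summable.
\<close>

lemma gliding_humps:
  assumes proper: "\<And>(x :: 'm::pointed_metric_space) r. compact (cball x r)"
    and inf: "infinite_dimensional (S_space :: ('m, real) Lip set)"
    and e: "\<And>k :: nat. 0 < e k"
  obtains h :: "nat \<Rightarrow> ('m::pointed_metric_space, real) Lip" and n :: "nat \<Rightarrow> nat"
  where "\<And>k. h k \<in> S_space \<inter> sphere 0 1" "\<And>k. k \<le> n k" "mono n"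
    "\<And>k x y. (x, y) \<notin> core_pairs (n k) \<Longrightarrow>
      \<bar>Lip_fun (h k) x - Lip_fun (h k) y\<bar> \<le> e k * dist x y"
    "\<And>k x y. (x, y) \<in> core_pairs (n k) \<Longrightarrow>
      \<bar>Lip_fun (h (Suc k)) x - Lip_fun (h (Suc k)) y\<bar> \<le> e (Suc k) * dist x y"
proof -
  define P where "P k hn \<longleftrightarrow> fst hn \<in> S_space \<inter> sphere 0 1 \<and> k \<le> snd hn \<and>
      (\<forall>x y. (x, y) \<notin> core_pairs (snd hn) \<longrightarrow>
        \<bar>Lip_fun (fst hn) x - Lip_fun (fst hn) y\<bar> \<le> e k * dist x y)"
    for k and hn :: "('m, real) Lip \<times> nat"
  define Q where "Q k hn hn' \<longleftrightarrow> snd hn \<le> snd hn' \<and>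
      (\<forall>x y. (x, y) \<in> core_pairs (snd hn) \<longrightarrow>
        \<bar>Lip_fun (fst hn') x - Lip_fun (fst hn') y\<bar> \<le> e (Suc k) * dist x y)"
    for k and hn hn' :: "('m, real) Lip \<times> nat"
  have next_hump: "\<exists>hn'. P k hn' \<and> m \<le> snd hn' \<and> (\<forall>x y. (x, y) \<in> core_pairs m \<longrightarrow>
      \<bar>Lip_fun (fst hn') x - Lip_fun (fst hn') y\<bar> \<le> e k * dist x y)" for k m
  proof -
    obtain g where g: "g \<in> S_space \<inter> sphere 0 1" "\<forall>(x :: 'm, y) \<in> core_pairs m.
        \<bar>Lip_fun g x - Lip_fun g y\<bar> \<le> e k * dist x y"
      using unit_function_slopes_small_on_core[OF proper inf e[of k]] by blast
    have "\<forall>\<^sub>F n in sequentially. \<forall>x y. (x, y) \<notin> core_pairs n \<longrightarrow>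
        norm (Lip_fun g x - Lip_fun g y) \<le> e k * dist x y"
      using g(1) e by (intro S_space_slopes_small_off_core) auto
    then have "\<forall>\<^sub>F n in sequentially. max k m \<le> n \<and> (\<forall>x y. (x, y) \<notin> core_pairs n \<longrightarrow>
        norm (Lip_fun g x - Lip_fun g y) \<le> e k * dist x y)"
      using eventually_ge_at_top by (rule eventually_conj[rotated])
    then obtain n where "max k m \<le> n" "\<forall>x y. (x, y) \<notin> core_pairs n \<longrightarrow>
        norm (Lip_fun g x - Lip_fun g y) \<le> e k * dist x y"
      using eventually_happens'[OF sequentially_bot] by blast
    then show ?thesis
      using g by (intro exI[of _ "(g, n)"]) (auto simp: P_def)
  qed
  have "\<exists>f. \<forall>k. P k (f k) \<and> Q k (f k) (f (Suc k))"
  proof (rule dependent_nat_choice)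
    show "\<exists>hn. P 0 hn" using next_hump by blast
    show "\<exists>hn'. P (Suc k) hn' \<and> Q k hn hn'" for k hn
      using next_hump[of "Suc k" "snd hn"] by (auto simp: Q_def)
  qed
  then obtain f where f: "\<And>k. P k (f k)" "\<And>k. Q k (f k) (f (Suc k))" by blast
  show ?thesis
  proof (rule that[of "fst \<circ> f" "snd \<circ> f"])
    show "mono (snd \<circ> f)"
      using f(2) by (auto simp: Q_def mono_iff_le_Suc)
  qed (use f in \<open>auto simp: P_def Q_def\<close>)
qed

text \<open>
  If \<open>p\<close> first enters the increasing sequence \<open>K\<close> at \<open>k0\<close>, then \<open>\<sigma> k\<close> is small for \<open>k < k0\<close> because
  \<open>p\<close> is not yet in \<open>K k\<close>, and for \<open>k > k0\<close> because \<open>p\<close> is already in \<open>K (k - 1)\<close>. So \<open>\<sigma> k0\<close> is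
  the only large term.
\<close>

lemma sum_gliding_humps_le:
  fixes \<sigma> e :: "nat \<Rightarrow> real"
  assumes K: "mono K" and I: "finite I" and e: "\<And>k. 0 \<le> e k" "sum e I \<le> C"
    and le: "\<And>k. \<sigma> k \<le> d" and d: "0 \<le> d"
    and off: "\<And>k. p \<notin> K k \<Longrightarrow> \<sigma> k \<le> e k * d"
    and on: "\<And>k. p \<in> K k \<Longrightarrow> \<sigma> (Suc k) \<le> e (Suc k) * d"
  shows "sum \<sigma> I \<le> (1 + C) * d"
proof -
  define k0 where "k0 = (LEAST k. p \<in> K k)"
  have small: "\<sigma> k \<le> e k * d" if k: "k \<noteq> k0" for k
  proof (cases "p \<in> K k")
    case True
    then have "p \<in> K k0" "k0 \<le> k"
      unfolding k0_def by (rule LeastI, rule Least_le)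
    moreover from this obtain j where j: "k = Suc j" "k0 \<le> j"
      using k by (cases k) (auto simp: le_Suc_eq)
    ultimately have "p \<in> K j" using monoD[OF K] by blast
    then show ?thesis using on j by simp
  qed (rule off)
  have "\<sigma> k \<le> (if k = k0 then d else 0) + e k * d" for k
    using small[of k] le[of k] e(1)[of k] d by (auto simp: add_increasing2)
  then have "sum \<sigma> I \<le> (\<Sum>k\<in>I. (if k = k0 then d else 0) + e k * d)"
    by (rule sum_mono)
  also have "\<dots> = (if k0 \<in> I then d else 0) + sum e I * d"
    using I by (simp add: sum.distrib sum_distrib_right)
  also have "\<dots> \<le> d + C * d"
    using d e(2) by (intro add_mono mult_right_mono) auto
  finally show ?thesis by (simp add: algebra_simps)
qed

section \<open>Vector-valued functions\<close>

lift_definition tensor :: "('m::pointed_metric_space, real) Lip \<Rightarrow> 'x::real_normed_vector \<Rightarrow> ('m, 'x) Lip"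
  is "\<lambda>h v x. h x *\<^sub>R v"
proof -
  fix h :: "'m \<Rightarrow> real" and v :: 'x
  assume "h origin = 0 \<and> (\<exists>C. C-lipschitz_on UNIV h)"
  then obtain C where C: "h origin = 0" "C-lipschitz_on UNIV h" by blast
  have "(norm v * C)-lipschitz_on UNIV (\<lambda>x. h x *\<^sub>R v)"
  proof (rule lipschitz_onI)
    fix x y
    show "dist (h x *\<^sub>R v) (h y *\<^sub>R v) \<le> norm v * C * dist x y"
      using mult_left_mono[OF lipschitz_onD[OF C(2), of x y], of "norm v"]
      by (simp add: dist_norm mult_ac flip: scaleR_left_diff_distrib)
  qed (simp add: lipschitz_on_nonneg[OF C(2)])
  then show "h origin *\<^sub>R v = 0 \<and> (\<exists>C. C-lipschitz_on UNIV (\<lambda>x. h x *\<^sub>R v))"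
    using C(1) by auto
qed

lemma norm_diff_tensor:
  "norm (Lip_fun (tensor h v) x - Lip_fun (tensor h v) y) = \<bar>Lip_fun h x - Lip_fun h y\<bar> * norm v"
  by (simp add: tensor.rep_eq flip: scaleR_left_diff_distrib)

lemma slope_sup_tensor:
  assumes "norm v = 1"
  shows "slope_sup (Lip_fun (tensor h v)) = slope_sup (Lip_fun h)"
  unfolding slope_sup_def by (simp add: norm_diff_tensor assms)

lemma norm_tensor: "norm v = 1 \<Longrightarrow> norm (tensor h v) = norm h"
  by (simp add: norm_Lip_def slope_sup_tensor)

lemma tensor_in_S_space_iff: "norm v = 1 \<Longrightarrow> tensor h v \<in> S_space \<longleftrightarrow> h \<in> S_space"
  by (simp add: S_space_def lip_space_def slope_sup_tensor)

lemma Lip_fun_sum: "Lip_fun (\<Sum>i\<in>I. f i) x = (\<Sum>i\<in>I. Lip_fun (f i) x)"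
  by (induction I rule: infinite_finite_induct) (simp_all add: zero_Lip.rep_eq plus_Lip.rep_eq)

theorem S_space_UASQ:
  assumes proper: "\<And>(x :: 'm::pointed_metric_space) r. compact (cball x r)"
    and nonzero: "\<exists>v :: 'x::real_normed_vector. v \<noteq> 0"
    and inf: "infinite_dimensional (S_space :: ('m, real) Lip set)"
  shows "UASQ (S_space :: ('m, 'x) Lip set)"
  unfolding UASQ_def
proof (intro allI impI)
  fix \<epsilon> :: real
  assume \<epsilon>: "0 < \<epsilon>"
  define e :: "nat \<Rightarrow> real" where "e k = \<epsilon> * (1 / 2) ^ Suc k" for k
  have e_pos: "0 < e k" for k using \<epsilon> by (simp add: e_def)
  have e_sums: "e sums \<epsilon>"
    using sums_mult[OF power_half_series, of \<epsilon>] by (simp add: e_def[abs_def])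
  have e_sum: "sum e I \<le> \<epsilon>" if "finite I" for I
    using sum_le_suminf[OF sums_summable[OF e_sums] that] sums_unique[OF e_sums] e_pos
    by (simp add: less_imp_le)
  obtain h :: "nat \<Rightarrow> ('m, real) Lip" and n :: "nat \<Rightarrow> nat"
    where h: "\<And>k. h k \<in> S_space \<inter> sphere 0 1" and n: "\<And>k. k \<le> n k" "mono n"
      and off: "\<And>k x y. (x, y) \<notin> core_pairs (n k) \<Longrightarrow>
        \<bar>Lip_fun (h k) x - Lip_fun (h k) y\<bar> \<le> e k * dist x y"
      and on: "\<And>k x y. (x, y) \<in> core_pairs (n k) \<Longrightarrow>
        \<bar>Lip_fun (h (Suc k)) x - Lip_fun (h (Suc k)) y\<bar> \<le> e (Suc k) * dist x y"
    using gliding_humps[where e = e, OF proper inf e_pos] by blast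
  obtain v :: 'x where v: "norm v = 1"
    using nonzero by (metis norm_sgn)
  define g where "g k = tensor (h k) v" for k
  have g_slope: "norm (Lip_fun (g k) x - Lip_fun (g k) y) = \<bar>Lip_fun (h k) x - Lip_fun (h k) y\<bar>"
    for k x y
    by (simp add: g_def norm_diff_tensor v)
  have g_unit: "g k \<in> S_space \<inter> sphere 0 1" for k
    using h[of k] by (simp add: g_def norm_tensor tensor_in_S_space_iff v)
  have slope_le: "norm (Lip_fun f x - Lip_fun f y) \<le> dist x y" if "norm f = 1"
    for f :: "('m, 'x) Lip" and x y
    using Lip_norm_bound[of f x y] that by simp
  show "\<exists>A. A \<subseteq> (S_space :: ('m, 'x) Lip set) \<inter> sphere 0 1 \<and>
    (\<forall>Y \<delta>. finite Y \<and> Y \<subseteq> S_space \<inter> sphere 0 1 \<and> 0 < \<delta> \<longrightarrow>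
      (\<exists>x\<in>A. \<forall>y\<in>Y. norm (y + x) \<le> 1 + \<delta> \<and> norm (y - x) \<le> 1 + \<delta>)) \<and>
    (\<forall>F \<xi>. finite F \<and> F \<subseteq> A \<and> (\<forall>x\<in>F. \<xi> x \<in> {-1, 1 :: real}) \<longrightarrow>
      norm (\<Sum>x\<in>F. \<xi> x *\<^sub>R x) \<le> 1 + \<epsilon>)"
  proof (intro exI[of _ "range g"] conjI allI impI; (elim conjE)?)
    show "range g \<subseteq> S_space \<inter> sphere 0 1" using g_unit by blast
  next
    fix Y :: "('m, 'x) Lip set" and \<delta> :: real
    assume Y: "finite Y" "Y \<subseteq> S_space \<inter> sphere 0 1" and \<delta>: "0 < \<delta>"
    have "\<forall>\<^sub>F m in sequentially. \<forall>f\<in>Y. \<forall>x y. (x, y) \<notin> core_pairs m \<longrightarrow>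
        norm (Lip_fun f x - Lip_fun f y) \<le> \<delta> * dist x y"
      using Y \<delta> by (intro eventually_ball_finite ballI S_space_slopes_small_off_core) auto
    moreover have "\<forall>\<^sub>F m in sequentially. e (Suc m) < \<delta>"
      using order_tendstoD(2)[OF summable_LIMSEQ_zero[OF sums_summable[OF e_sums]] \<delta>]
        eventually_sequentially_Suc[of "\<lambda>m. e m < \<delta>"] by simp
    ultimately have "\<forall>\<^sub>F m in sequentially. (\<forall>f\<in>Y. \<forall>x y. (x, y) \<notin> core_pairs m \<longrightarrow>
        norm (Lip_fun f x - Lip_fun f y) \<le> \<delta> * dist x y) \<and> e (Suc m) < \<delta>"
      by (rule eventually_conj)
    then obtain m where m: "\<And>f x y. f \<in> Y \<Longrightarrow> (x, y) \<notin> core_pairs m \<Longrightarrow>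
        norm (Lip_fun f x - Lip_fun f y) \<le> \<delta> * dist x y" "e (Suc m) < \<delta>"
      unfolding eventually_sequentially by blast
    \<comment> \<open>On \<open>core_pairs m\<close> the hump is small, off it the functions in \<open>Y\<close> are. The index is
      \<open>Suc m\<close> since \<open>h (Suc m)\<close> is small on \<open>core_pairs (n m)\<close>, which contains \<open>core_pairs m\<close>.\<close>
    let ?g = "g (Suc m)"
    have slopes: "norm (Lip_fun f x - Lip_fun f y) + norm (Lip_fun ?g x - Lip_fun ?g y)
        \<le> (1 + \<delta>) * dist x y" if f: "f \<in> Y" for f x y
    proof (cases "(x, y) \<in> core_pairs m")
      case True
      then have "(x, y) \<in> core_pairs (n m)"
        using core_pairs_mono[OF n(1)] by blast
      then have "norm (Lip_fun ?g x - Lip_fun ?g y) \<le> e (Suc m) * dist x y"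
        using on by (simp add: g_slope)
      also have "\<dots> \<le> \<delta> * dist x y"
        using m(2) by (intro mult_right_mono) auto
      finally show ?thesis
        using slope_le[of f x y] f Y(2) by (force simp: algebra_simps)
    next
      case False
      then show ?thesis
        using m(1)[OF f, of x y] slope_le[of ?g x y] g_unit[of "Suc m"] by (simp add: algebra_simps)
    qed
    have "norm (f + ?g) \<le> 1 + \<delta> \<and> norm (f - ?g) \<le> 1 + \<delta>" if f: "f \<in> Y" for f
    proof (intro conjI Lip_norm_leI)
      fix x y
      show "norm (Lip_fun (f + ?g) x - Lip_fun (f + ?g) y) \<le> (1 + \<delta>) * dist x y"
        using slopes[OF f, of x y] norm_diff_triangle_ineq[of "Lip_fun f x" "Lip_fun ?g x"]
        by (force simp: plus_Lip.rep_eq intro: order_trans)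
      have "Lip_fun (f - ?g) x - Lip_fun (f - ?g) y
          = (Lip_fun f x - Lip_fun f y) - (Lip_fun ?g x - Lip_fun ?g y)"
        by (simp add: minus_Lip.rep_eq)
      then show "norm (Lip_fun (f - ?g) x - Lip_fun (f - ?g) y) \<le> (1 + \<delta>) * dist x y"
        using slopes[OF f, of x y] norm_triangle_ineq4 by (metis order_trans)
    qed (use \<delta> in auto)
    then show "\<exists>x\<in>range g. \<forall>y\<in>Y. norm (y + x) \<le> 1 + \<delta> \<and> norm (y - x) \<le> 1 + \<delta>"
      by blast
  next
    fix F :: "('m, 'x) Lip set" and \<xi> :: "('m, 'x) Lip \<Rightarrow> real"
    assume F: "finite F" "F \<subseteq> range g" and \<xi>: "\<forall>x\<in>F. \<xi> x \<in> {-1, 1}"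
    \<comment> \<open>The sequence \<open>g\<close> may repeat values, so one index is chosen for each element of \<open>F\<close>.\<close>
    obtain I where I: "inj_on g I" "F = g ` I"
      using F(2) by (meson subset_image_inj)
    then have finI: "finite I" using F(1) by (simp add: finite_image_iff)
    show "norm (\<Sum>x\<in>F. \<xi> x *\<^sub>R x) \<le> 1 + \<epsilon>"
    proof (rule Lip_norm_leI)
      fix x y :: 'm
      let ?\<sigma> = "\<lambda>k. norm (Lip_fun (g k) x - Lip_fun (g k) y)"
      have "Lip_fun (\<Sum>f\<in>F. \<xi> f *\<^sub>R f) x - Lip_fun (\<Sum>f\<in>F. \<xi> f *\<^sub>R f) y
          = (\<Sum>k\<in>I. \<xi> (g k) *\<^sub>R (Lip_fun (g k) x - Lip_fun (g k) y))"
        unfolding I(2) using I(1)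
        by (simp add: sum.reindex Lip_fun_sum scaleR_Lip.rep_eq scaleR_right_diff_distrib sum_subtractf)
      also have "norm \<dots> \<le> (\<Sum>k\<in>I. ?\<sigma> k)"
        using \<xi> I(2) by (intro sum_norm_le) auto
      also have "\<dots> \<le> (1 + \<epsilon>) * dist x y"
      proof (rule sum_gliding_humps_le[where K = "\<lambda>k. core_pairs (n k)" and p = "(x, y)" and e = e])
        show "mono (\<lambda>k. core_pairs (n k) :: ('m \<times> 'm) set)"
          using n(2) by (intro monoI core_pairs_mono) (rule monoD)
        show "?\<sigma> k \<le> dist x y" for k
          using slope_le g_unit[of k] by simp
      qed (use finI e_pos e_sum off on in \<open>auto simp: g_slope less_imp_le\<close>)
      finally show "norm (Lip_fun (\<Sum>f\<in>F. \<xi> f *\<^sub>R f) x - Lip_fun (\<Sum>f\<in>F. \<xi> f *\<^sub>R f) y)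
          \<le> (1 + \<epsilon>) * dist x y" .
    qed (use \<epsilon> in simp)
  qed
qed

lemma lip_space_eq_S_space_if_bounded:
  assumes "bounded (UNIV :: 'm::pointed_metric_space set)"
  shows "(lip_space :: ('m, 'x::real_normed_vector) Lip set) = S_space"
proof -
  obtain R where R: "\<And>x :: 'm. dist origin x \<le> R"
    using assms unfolding bounded_any_center[where a = origin] by blast
  have "slope_sup (Lip_fun f) {(x, y). x \<noteq> y \<and> (x \<notin> ball origin r \<or> y \<notin> ball origin r)} = 0"
    if "R < r" for f :: "('m, 'x) Lip" and r
  proof -
    have "x \<in> ball origin r" for x :: 'm
      using R[of x] that by simp
    then show ?thesis by (simp add: slope_sup_def)
  qed
  then have "((\<lambda>r. slope_sup (Lip_fun f) {(x, y). x \<noteq> y \<and> (x \<notin> ball origin r \<or> y \<notin> ball origin r)})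
      \<longlongrightarrow> 0) at_top" for f :: "('m, 'x) Lip"
    by (intro tendsto_eventually eventually_mono[OF eventually_gt_at_top[of R]]) blast
  then show ?thesis by (auto simp: S_space_def)
qed

theorem theorem5p3:
  assumes proper: "\<And>(x :: 'm::pointed_metric_space) r. compact (cball x r)"
    and nonzero: "\<exists>v :: 'x::banach. v \<noteq> 0"
  shows "(infinite_dimensional (S_space :: ('m, real) Lip set) \<longrightarrow>
      UASQ (S_space :: ('m, 'x) Lip set) \<and>
      \<not> isometrically_isomorphic (S_space :: ('m, 'x) Lip set)
          (UNIV :: ('b::banach \<Rightarrow>\<^sub>L real) set)) \<and>
    (compact (UNIV :: 'm set) \<longrightarrow> infinite_dimensional (lip_space :: ('m, real) Lip set) \<longrightarrow>
      UASQ (lip_space :: ('m, 'x) Lip set) \<and>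
      \<not> isometrically_isomorphic (lip_space :: ('m, 'x) Lip set)
          (UNIV :: ('b \<Rightarrow>\<^sub>L real) set))"
proof -
  have S: "UASQ (S_space :: ('m, 'x) Lip set) \<and>
      \<not> isometrically_isomorphic (S_space :: ('m, 'x) Lip set) (UNIV :: ('b \<Rightarrow>\<^sub>L real) set)"
    if "infinite_dimensional (S_space :: ('m, real) Lip set)"
    using S_space_UASQ[OF proper nonzero that]
      UASQ_isometrically_isomorphic[OF subspace_S_space] dual_not_UASQ by blast
  show ?thesis
    using S lip_space_eq_S_space_if_bounded[OF compact_imp_bounded, where 'm = 'm] by metis
qed

end
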